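(* Let $(k_n)$ be a sequence of positive integers with $k_n=o(n^{1/2})$, and for each $n$ let ${\bm w}=(w_k^{[j]})_{j\in\{L,R\},\,1\le k\le k_n} \in \{0,1\}^{2k_n}$. Then $$ \lim_{n \to \infty} \left(\mathbf{P}_{n}^*\left( \left(X_{k}^{[j]}\right)_{j \in \{L,R\},\, 1 \leq k \leq k_n} = {\bm w} \right) - \frac{1}{2^{2k_n}} \right)=0. $$
   Context: A strongly unimodal sequence $\lambda$ of size $n$ is a finite sequence of positive integers $\lambda_{1}^{[L]} < \dots < \lambda_{r}^{[L]} < \lambda_{\mathrm{PK}} > \lambda_{s}^{[R]} > \dots > \lambda_{1}^{[R]}$ ($r,s\ge 0$) with distinguished entry $\lambda_{\mathrm{PK}}$ (the peak), such that $\lambda_{\mathrm{PK}}+\sum_{k=1}^r\lambda_k^{[L]}+\sum_{k=1}^s\lambda_k^{[R]}=n$. Let $\mathcal{U}^*_n$ be the set of strongly unimodal sequences of size $n$ and $\mathbf{P}^*_n$ the uniform probability measure on $\mathcal{U}^*_n$. $X_k^{[L]}(\lambda)$ (resp. $X_k^{[R]}(\lambda)$) is the number of parts equal to $k$ among the parts to the left (resp. right) of the peak (so it is $0$ or $1$); the peak itself is not counted. *)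

theory Defs
  imports "HOL-Probability.Probability" "HOL-Library.Landau_Symbols"
begin

datatype side = SideL | SideR

text \<open>
  A sequence with a distinguished entry. Both lists are written in reading order, so the
  last element of \<open>left_parts\<close> and the first element of \<open>right_parts\<close> are the neighbours
  of the peak.
\<close>

datatype peaked_seq =
  Peaked_Seq (left_parts: "nat list") (peak: nat) (right_parts: "nat list")

definition strongly_unimodal :: "peaked_seq \<Rightarrow> bool" where
  "strongly_unimodal u \<longleftrightarrow>
     (\<forall>x \<in> set (left_parts u @ peak u # right_parts u). 0 < x) \<and>
     sorted_wrt (<) (left_parts u @ [peak u]) \<and>
     sorted_wrt (>) (peak u # right_parts u)"

definition seq_size :: "peaked_seq \<Rightarrow> nat" where
  "seq_size u = peak u + sum_list (left_parts u) + sum_list (right_parts u)"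

definition strongly_unimodal_seqs :: "nat \<Rightarrow> peaked_seq set" where
  "strongly_unimodal_seqs n = {u. strongly_unimodal u \<and> seq_size u = n}"

primrec side_parts :: "side \<Rightarrow> peaked_seq \<Rightarrow> nat list" where
  "side_parts SideL u = left_parts u"
| "side_parts SideR u = right_parts u"

definition part_count :: "side \<Rightarrow> nat \<Rightarrow> peaked_seq \<Rightarrow> nat" where
  "part_count j k u = count_list (side_parts j u) k"

text \<open>
  \<open>pmf_of_set\<close> is the uniform distribution only on a finite nonempty set; the two lemmas
  below show that this is the case for every \<open>n \<ge> 1\<close>. For \<open>n = 0\<close> there are no sequences.
\<close>

definition uniform_unimodal :: "nat \<Rightarrow> peaked_seq pmf" where
  "uniform_unimodal n = pmf_of_set (strongly_unimodal_seqs n)"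

lemma length_le_sum_list:
  fixes xs :: "nat list"
  assumes "\<forall>x \<in> set xs. 0 < x"
  shows "length xs \<le> sum_list xs"
  using assms by (induction xs) auto

lemma finite_strongly_unimodal_seqs: "finite (strongly_unimodal_seqs n)"
proof -
  let ?A = "{xs. set xs \<subseteq> {..n} \<and> length xs \<le> n}"
  have sub: "strongly_unimodal_seqs n \<subseteq>
      (\<lambda>(xs, p, ys). Peaked_Seq xs p ys) ` (?A \<times> {..n} \<times> ?A)"
  proof
    fix u assume u: "u \<in> strongly_unimodal_seqs n"
    obtain xs p ys where [simp]: "u = Peaked_Seq xs p ys" by (cases u)
    have pos: "\<forall>x \<in> set xs. 0 < x" "\<forall>x \<in> set ys. 0 < x"
      and sum: "p + sum_list xs + sum_list ys = n"
      using u by (auto simp: strongly_unimodal_seqs_def strongly_unimodal_def seq_size_def)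
    have le: "x \<le> n" if "x \<in> set xs \<union> set ys" for x
      using that member_le_sum_list[of x xs] member_le_sum_list[of x ys] sum by auto
    have "xs \<in> ?A" "ys \<in> ?A"
      using le sum length_le_sum_list[OF pos(1)] length_le_sum_list[OF pos(2)] by auto
    moreover have "p \<in> {..n}" using sum by simp
    ultimately show "u \<in> (\<lambda>(xs, p, ys). Peaked_Seq xs p ys) ` (?A \<times> {..n} \<times> ?A)"
      by (intro image_eqI[of _ _ "(xs, p, ys)"]) auto
  qed
  have "finite ?A" by (rule finite_lists_length_le) simp
  then show ?thesis using sub by (meson finite_SigmaI finite_atMost finite_imageI finite_subset)
qed

lemma strongly_unimodal_seqs_nonempty:
  assumes "1 \<le> n"
  shows "strongly_unimodal_seqs n \<noteq> {}"
proof -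
  have "Peaked_Seq [] n [] \<in> strongly_unimodal_seqs n"
    using assms by (simp add: strongly_unimodal_seqs_def strongly_unimodal_def seq_size_def)
  then show ?thesis by blast
qed

end

(*
  Fix K and let f(n) be the number of sequences of size n all of whose parts, the peak included,
  exceed K. Prescribing the parts up to K turns the count at size n into f(n - s) with s bounded,
  so for fixed K all patterns become equally likely once f(n) / f(n + 1) tends to 1. Raising the
  peak by 1 is injective and misses only the sequences with a part equal to the peak minus 1.
  Moving any other part of such a sequence into the peak is injective as well, so those with many
  parts are a small fraction of all; those with few parts are polynomially many, while f grows
  superpolynomially. Since the error in the theorem is additive, a pattern of unbounded length is
  compared with its restriction to a large fixed K, whose probability is already small.
*)
theory Submission
  imports Defs "HOL-Real_Asymp.Real_Asymp"
begin

section \<open>Sequences with all parts above a threshold, and raising the peak\<close>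

text \<open>A strictly monotone side is determined by its set of parts, so a triple encodes a
  sequence of size \<open>n\<close> with left parts \<open>A\<close>, right parts \<open>B\<close>
  and peak \<open>p\<close>. The case \<open>K = 0\<close> encodes all sequences.\<close>

definition peaked_sets :: "nat \<Rightarrow> nat \<Rightarrow> (nat set \<times> nat set \<times> nat) set" where
  "peaked_sets K n = {(A, B, p). A \<subseteq> {K<..<p} \<and> B \<subseteq> {K<..<p} \<and> K < p \<and> p + \<Sum>A + \<Sum>B = n}"

lemma peaked_sets_finite_parts:
  assumes "(A, B, p) \<in> peaked_sets K n"
  shows "finite A" "finite B"
  using assms by (auto simp: peaked_sets_def intro: finite_subset[of _ "{K<..<p}"])

lemma peaked_sets_subset: "peaked_sets K n \<subseteq> Pow {..n} \<times> Pow {..n} \<times> {..n}"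
proof
  fix x assume x: "x \<in> peaked_sets K n"
  obtain A B p where [simp]: "x = (A, B, p)" by (cases x)
  have "a \<le> n" if "a \<in> A \<union> B" for a
  proof -
    have "a < p" "p \<le> n" using x that by (auto simp: peaked_sets_def)
    then show ?thesis by simp
  qed
  then show "x \<in> Pow {..n} \<times> Pow {..n} \<times> {..n}" using x by (auto simp: peaked_sets_def)
qed

lemma finite_peaked_sets: "finite (peaked_sets K n)"
  by (rule finite_subset[OF peaked_sets_subset]) auto

text \<open>Raising the peak by 1 embeds size \<open>n\<close> into size \<open>Suc n\<close>. What
  it misses are the triples whose peak cannot be lowered because it would collide with a part
  \<open>p - 1\<close>.\<close>

lemma card_peaked_sets_Suc:
  assumes "K < n"
  shows "card (peaked_sets K (Suc n)) =
    card (peaked_sets K n) + card {(A, B, p) \<in> peaked_sets K (Suc n). p - 1 \<in> A \<union> B}"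
    (is "_ = _ + card ?D")
proof -
  let ?f = "\<lambda>(A :: nat set, B :: nat set, p). (A, B, Suc p)"
  have "x \<in> ?f ` peaked_sets K n" if x: "x \<in> peaked_sets K (Suc n)" "x \<notin> ?D" for x
  proof -
    obtain A B p where [simp]: "x = (A, B, p)" by (cases x)
    have AB: "A \<subseteq> {K<..<p}" "B \<subseteq> {K<..<p}" "K < p" "p + \<Sum>A + \<Sum>B = Suc n"
      and nin: "p - 1 \<notin> A" "p - 1 \<notin> B"
      using x by (auto simp: peaked_sets_def)
    \<comment> \<open>The only other obstruction to lowering the peak is the threshold. A peak
      \<open>Suc K\<close> leaves no room for parts and would force \<open>n = K\<close>.\<close>
    have "p \<noteq> Suc K"
    proof
      assume "p = Suc K"
      then have "A = {}" "B = {}"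
        using AB(1,2) greaterThanLessThan_empty_iff2 by (auto simp: atLeastSucLessThan_greaterThanLessThan[symmetric])
      then show False using AB(4) \<open>p = Suc K\<close> assms by simp
    qed
    moreover have "a < p - 1" if "a \<in> A \<union> B" for a
    proof -
      have "a < p" "a \<noteq> p - 1" using that AB(1,2) nin by auto
      then show ?thesis by simp
    qed
    ultimately have "(A, B, p - 1) \<in> peaked_sets K n"
      using AB by (auto simp: peaked_sets_def)
    then show ?thesis using AB(3) by (intro image_eqI[of _ _ "(A, B, p - 1)"]) auto
  qed
  moreover have "?f ` peaked_sets K n \<subseteq> peaked_sets K (Suc n)"
    by (auto simp: peaked_sets_def subset_iff less_Suc_eq)
  ultimately have "peaked_sets K (Suc n) = ?f ` peaked_sets K n \<union> ?D" by blast
  moreover have "?f ` peaked_sets K n \<inter> ?D = {}"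
    by (auto simp: peaked_sets_def subset_iff)
  moreover have "card (?f ` peaked_sets K n) = card (peaked_sets K n)"
    by (rule card_image) (auto simp: inj_on_def)
  ultimately show ?thesis
    by (metis (no_types, lifting) card_Un_disjoint finite_Un finite_peaked_sets)
qed

section \<open>Triples with a part directly below the peak\<close>

lemma sum_set_remove:
  assumes "finite A" "(t::nat) \<in> A"
  shows "t + \<Sum>(A - {t}) = \<Sum>A"
  using sum.remove[OF assms, of "\<lambda>x. x"] by simp

text \<open>Used below with \<open>Y x\<close> the set of parts of \<open>x\<close> that may be
  moved into the peak: \<open>m\<close> choices each, together with an injective move, make the set
  \<open>X\<close> at most a fraction 1/\<open>m\<close> of the target.\<close>

lemma card_Sigma_lower:
  assumes "finite X" "\<And>x. x \<in> X \<Longrightarrow> m \<le> card (Y x)" "\<And>x. x \<in> X \<Longrightarrow> finite (Y x)"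
  shows "m * card X \<le> card (Sigma X Y)"
proof -
  have "m * card X = (\<Sum>x\<in>X. m)" by simp
  also have "\<dots> \<le> (\<Sum>x\<in>X. card (Y x))" using assms(2) by (rule sum_mono)
  finally show ?thesis using assms by simp
qed

text \<open>
  Moving a part \<open>t\<close> into the peak is injective here: the largest remaining part is \<open>p - 1\<close>,
  so \<open>t\<close> can be read off the gap below the new peak \<open>p + t\<close>.
\<close>

lemma card_full_many_left:
  "m * card {(A, B, p) \<in> peaked_sets K n. p - 1 \<in> A \<and> m < card A} \<le> card (peaked_sets K n)"
proof -
  define X where "X = {(A, B, p) \<in> peaked_sets K n. p - 1 \<in> A \<and> m < card A}"
  define Y where "Y = (\<lambda>(A :: nat set, B :: nat set, p). A - {p - 1})"
  define f where "f = (\<lambda>((A, B :: nat set, p), t::nat). (A - {t}, B, p + t))"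
  have "finite X" unfolding X_def by (rule finite_subset[OF _ finite_peaked_sets]) auto
  then have "m * card X \<le> card (Sigma X Y)"
    by (rule card_Sigma_lower) (auto simp: X_def Y_def dest: peaked_sets_finite_parts)
  also have "\<dots> \<le> card (peaked_sets K n)"
  proof (rule card_inj_on_le[OF _ _ finite_peaked_sets])
    show "inj_on f (Sigma X Y)"
    proof (rule inj_onI)
      fix x y assume x: "x \<in> Sigma X Y" and y: "y \<in> Sigma X Y" and eq: "f x = f y"
      obtain A B p t where [simp]: "x = ((A, B, p), t)" by (metis prod.exhaust)
      obtain A' B' p' t' where [simp]: "y = ((A', B', p'), t')" by (metis prod.exhaust)
      have e: "A - {t} = A' - {t'}" "B = B'" "p + t = p' + t'"
        using eq by (auto simp: f_def)
      have a: "A \<subseteq> {K<..<p}" "p - 1 \<in> A - {t}" "t \<in> A"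
        using x by (auto simp: X_def Y_def peaked_sets_def)
      have b: "A' \<subseteq> {K<..<p'}" "p' - 1 \<in> A' - {t'}" "t' \<in> A'"
        using y by (auto simp: X_def Y_def peaked_sets_def)
      have "p - 1 \<in> {K<..<p'}" "p' - 1 \<in> {K<..<p}" using a(1,2) b(1,2) e(1) by blast+
      moreover have "p - 1 \<in> {K<..<p}" "p' - 1 \<in> {K<..<p'}" using a(1,2) b(1,2) by blast+
      ultimately have "p = p'" unfolding greaterThanLessThan_iff by linarith
      then show "x = y" using e a(3) b(3) by auto
    qed
    show "f ` Sigma X Y \<subseteq> peaked_sets K n"
    proof
      fix z assume "z \<in> f ` Sigma X Y"
      then obtain A B p t where z: "z = (A - {t}, B, p + t)" and x: "(A, B, p) \<in> peaked_sets K n" "t \<in> A"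
        by (auto simp: X_def Y_def f_def)
      have "t + \<Sum>(A - {t}) = \<Sum>A"
        using peaked_sets_finite_parts[OF x(1)] x(2) by (intro sum_set_remove)
      then show "z \<in> peaked_sets K n" using x unfolding z peaked_sets_def by force
    qed
  qed
  finally show ?thesis unfolding X_def .
qed

text \<open>Here the moved part comes from the other side, so \<open>A\<close> stays intact and its
  largest element \<open>p - 1\<close> reveals the old peak. Hence any part of \<open>B\<close> may
  be moved, while on the left \<open>p - 1\<close> itself had to be spared.\<close>

lemma card_full_many_right:
  "m * card {(A, B, p) \<in> peaked_sets K n. p - 1 \<in> A \<and> m < card B} \<le> card (peaked_sets K n)"
proof -
  define X where "X = {(A, B, p) \<in> peaked_sets K n. p - 1 \<in> A \<and> m < card B}"
  define Y where "Y = (\<lambda>(A :: nat set, B :: nat set, p :: nat). B)"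
  define f where "f = (\<lambda>((A :: nat set, B, p), t::nat). (A, B - {t}, p + t))"
  have "finite X" unfolding X_def by (rule finite_subset[OF _ finite_peaked_sets]) auto
  then have "m * card X \<le> card (Sigma X Y)"
    by (rule card_Sigma_lower) (auto simp: X_def Y_def dest: peaked_sets_finite_parts)
  also have "\<dots> \<le> card (peaked_sets K n)"
  proof (rule card_inj_on_le[OF _ _ finite_peaked_sets])
    show "inj_on f (Sigma X Y)"
    proof (rule inj_onI)
      fix x y assume x: "x \<in> Sigma X Y" and y: "y \<in> Sigma X Y" and eq: "f x = f y"
      obtain A B p t where [simp]: "x = ((A, B, p), t)" by (metis prod.exhaust)
      obtain A' B' p' t' where [simp]: "y = ((A', B', p'), t')" by (metis prod.exhaust)
      have e: "B - {t} = B' - {t'}" "A = A'" "p + t = p' + t'"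
        using eq by (auto simp: f_def)
      have a: "A \<subseteq> {K<..<p}" "p - 1 \<in> A" "t \<in> B"
        using x by (auto simp: X_def Y_def peaked_sets_def)
      have b: "A' \<subseteq> {K<..<p'}" "p' - 1 \<in> A'" "t' \<in> B'"
        using y by (auto simp: X_def Y_def peaked_sets_def)
      have "p - 1 \<in> {K<..<p'}" "p' - 1 \<in> {K<..<p}" using a(1,2) b(1,2) e(2) by blast+
      moreover have "p - 1 \<in> {K<..<p}" "p' - 1 \<in> {K<..<p'}" using a(1,2) b(1,2) by blast+
      ultimately have "p = p'" unfolding greaterThanLessThan_iff by linarith
      then show "x = y" using e a(3) b(3) by auto
    qed
    show "f ` Sigma X Y \<subseteq> peaked_sets K n"
    proof
      fix z assume "z \<in> f ` Sigma X Y"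
      then obtain A B p t where z: "z = (A, B - {t}, p + t)" and x: "(A, B, p) \<in> peaked_sets K n" "t \<in> B"
        by (auto simp: X_def Y_def f_def)
      have "t + \<Sum>(B - {t}) = \<Sum>B"
        using peaked_sets_finite_parts[OF x(1)] x(2) by (intro sum_set_remove)
      then show "z \<in> peaked_sets K n" using x unfolding z peaked_sets_def by force
    qed
  qed
  finally show ?thesis unfolding X_def .
qed

text \<open>Padding with \<open>0\<close>, which is never a part, turns a set of at most \<open>m\<close> parts into a list of length \<open>m\<close>.\<close>

lemma card_peaked_sets_few_parts:
  "card {(A, B, p) \<in> peaked_sets K n. card A \<le> m \<and> card B \<le> m} \<le> Suc n ^ (2 * m + 1)"
    (is "card ?F \<le> _")
proof -
  let ?L = "{xs. set xs \<subseteq> {..n} \<and> length xs = m}"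
  let ?g = "\<lambda>(xs, ys, p :: nat). (set xs - {0::nat}, set ys - {0::nat}, p)"
  have list: "\<exists>xs \<in> ?L. A = set xs - {0}" if "A \<subseteq> {..n}" "0 \<notin> A" "card A \<le> m" for A
  proof -
    have "finite A" using that(1) finite_subset by blast
    then show ?thesis using that
      by (intro bexI[of _ "sorted_list_of_set A @ replicate (m - card A) 0"]) auto
  qed
  have "?F \<subseteq> ?g ` (?L \<times> ?L \<times> {..n})"
  proof
    fix x assume x: "x \<in> ?F"
    obtain A B p where [simp]: "x = (A, B, p)" by (cases x)
    have "A \<subseteq> {..n}" "B \<subseteq> {..n}" "p \<le> n" "0 \<notin> A" "0 \<notin> B" "card A \<le> m" "card B \<le> m"
      using x peaked_sets_subset[of K n] by (auto simp: peaked_sets_def)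
    then obtain xs ys where "xs \<in> ?L" "A = set xs - {0}" "ys \<in> ?L" "B = set ys - {0}" "p \<le> n"
      using list by meson
    then show "x \<in> ?g ` (?L \<times> ?L \<times> {..n})"
      by (intro image_eqI[of _ _ "(xs, ys, p)"]) auto
  qed
  moreover have fin: "finite (?L \<times> ?L \<times> {..n})"
    by (intro finite_cartesian_product finite_lists_length_eq) auto
  ultimately have "card ?F \<le> card (?L \<times> ?L \<times> {..n})"
    by (rule surj_card_le[rotated])
  also have "\<dots> = Suc n ^ (2 * m + 1)"
    by (simp only: card_cartesian_product card_lists_length_eq finite_atMost card_atMost mult_2
        power_add power_one_right mult.assoc)
  finally show ?thesis .
qed

text \<open>Three cases cover everything: more than \<open>m\<close> parts on the left, more than
  \<open>m\<close> on the right, at most \<open>m\<close> on both sides. Each of the first two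
  contributes at most 1/\<open>m\<close> of all triples, the last only polynomially many.\<close>

lemma card_full_left_le:
  "m * card {(A, B, p) \<in> peaked_sets K n. p - 1 \<in> A}
    \<le> 2 * card (peaked_sets K n) + m * Suc n ^ (2 * m + 1)"
    (is "m * card ?D \<le> _")
proof -
  let ?X = "{(A, B, p) \<in> peaked_sets K n. p - 1 \<in> A \<and> m < card A}"
  let ?Y = "{(A, B, p) \<in> peaked_sets K n. p - 1 \<in> A \<and> m < card B}"
  let ?F = "{(A, B, p) \<in> peaked_sets K n. card A \<le> m \<and> card B \<le> m}"
  have "?D \<subseteq> ?X \<union> ?Y \<union> ?F" by auto
  moreover have "finite (?X \<union> ?Y \<union> ?F)" by (rule finite_subset[OF _ finite_peaked_sets]) auto
  ultimately have "card ?D \<le> card (?X \<union> ?Y \<union> ?F)" by (rule card_mono[rotated])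
  also have "\<dots> \<le> card ?X + card ?Y + card ?F"
    by (meson card_Un_le add_right_mono order_trans)
  finally have "m * card ?D \<le> m * card ?X + m * card ?Y + m * card ?F"
    unfolding add_mult_distrib2[symmetric] by (rule mult_le_mono2)
  moreover have "m * card ?F \<le> m * Suc n ^ (2 * m + 1)"
    using card_peaked_sets_few_parts by (rule mult_le_mono2)
  ultimately show ?thesis
    using card_full_many_left[of m K n] card_full_many_right[of m K n] by linarith
qed

text \<open>Exchanging the two sides carries the bound for \<open>A\<close> over to
  \<open>B\<close>, which doubles the constants.\<close>

lemma card_full_le:
  "m * card {(A, B, p) \<in> peaked_sets K n. p - 1 \<in> A \<union> B}
    \<le> 4 * card (peaked_sets K n) + 2 * m * Suc n ^ (2 * m + 1)"
proof -
  let ?L = "{(A, B, p) \<in> peaked_sets K n. p - 1 \<in> A}"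
  let ?R = "{(A, B, p) \<in> peaked_sets K n. p - 1 \<in> B}"
  have "?R = (\<lambda>(A, B, p). (B, A, p)) ` ?L"
    by (force simp: peaked_sets_def image_iff add.commute add.left_commute)
  moreover have "finite ?L" by (rule finite_subset[OF _ finite_peaked_sets]) auto
  ultimately have "card ?R \<le> card ?L" by (simp only: card_image_le)
  moreover have "{(A, B, p) \<in> peaked_sets K n. p - 1 \<in> A \<union> B} = ?L \<union> ?R" by auto
  ultimately have "card {(A, B, p) \<in> peaked_sets K n. p - 1 \<in> A \<union> B} \<le> 2 * card ?L"
    using card_Un_le[of ?L ?R] by simp
  from mult_le_mono2[OF this, of m] show ?thesis
    using card_full_left_le[of m K n] by linarith
qed

section \<open>Superpolynomial growth\<close>

text \<open>Any subset of the \<open>r\<close> integers following \<open>K\<close> can serve as the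
  left side, with an empty right side and the peak absorbing the remaining size. The hypothesis
  keeps that peak above \<open>K + r\<close>.\<close>

lemma card_peaked_sets_lower:
  assumes "Suc (r + K) * Suc r + K \<le> n"
  shows "2 ^ r \<le> card (peaked_sets K n)"
proof -
  let ?I = "{K<..K + r}"
  let ?f = "\<lambda>C. (C, {} :: nat set, n - \<Sum>C)"
  have "card (Pow ?I) \<le> card (peaked_sets K n)"
  proof (rule card_inj_on_le[OF _ _ finite_peaked_sets])
    show "inj_on ?f (Pow ?I)" by (auto simp: inj_on_def)
    show "?f ` Pow ?I \<subseteq> peaked_sets K n"
    proof
      fix x assume "x \<in> ?f ` Pow ?I"
      then obtain C where C: "C \<subseteq> ?I" and [simp]: "x = ?f C" by auto
      have "\<Sum>C \<le> \<Sum>?I" by (rule sum_mono2) (use C in auto)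
      also have "\<dots> \<le> card ?I * (K + r)" using sum_bounded_above[of ?I "\<lambda>x. x" "K + r"] by simp
      finally have "\<Sum>C + K + r < n" using assms by (simp add: algebra_simps)
      then show "x \<in> peaked_sets K n" using C unfolding peaked_sets_def by force
    qed
  qed
  then show ?thesis by (simp add: card_Pow)
qed

lemma card_peaked_sets_superpolynomial:
  "(\<lambda>n. real (Suc n) ^ d / real (card (peaked_sets K n))) \<longlonglongrightarrow> 0"
proof (rule tendsto_sandwich[OF _ _ tendsto_const])
  \<comment> \<open>The size condition for the lower bound 2^\<open>r\<close> is quadratic in
    \<open>r\<close>, so any exponent strictly between 0 and 1/2 would serve.\<close>
  let ?r = "\<lambda>n. nat \<lfloor>real n powr (1/3)\<rfloor>"
  have "eventually (\<lambda>n. (n powr (1/3) + K + 1) * (n powr (1/3) + 1) + K \<le> real n) sequentially"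
    by real_asymp
  then show "eventually (\<lambda>n. real (Suc n) ^ d / real (card (peaked_sets K n))
      \<le> real (Suc n) ^ d / 2 powr (real n powr (1/3) - 1)) sequentially"
  proof eventually_elim
    case (elim n)
    define r where "r = ?r n"
    have r: "real r \<le> real n powr (1/3)" "real n powr (1/3) - 1 \<le> real r"
      unfolding r_def by (simp, linarith)
    have "real (Suc (r + K) * Suc r + K) \<le> (n powr (1/3) + K + 1) * (n powr (1/3) + 1) + K"
      unfolding of_nat_add of_nat_mult of_nat_Suc
      using r(1) by (intro add_right_mono mult_mono) auto
    also have "\<dots> \<le> real n" by (rule elim)
    finally have "2 ^ r \<le> card (peaked_sets K n)"
      using card_peaked_sets_lower of_nat_le_iff by blast
    then have "real (2 ^ r) \<le> real (card (peaked_sets K n))" by (simp only: of_nat_le_iff)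
    moreover have "2 powr (real n powr (1/3) - 1) \<le> 2 powr real r" using r(2) by simp
    moreover have "2 powr real r = real (2 ^ r)" by (simp add: powr_realpow)
    ultimately have "2 powr (real n powr (1/3) - 1) \<le> real (card (peaked_sets K n))" by linarith
    moreover from this have "0 < real (card (peaked_sets K n))"
      by (rule less_le_trans[rotated]) simp
    ultimately show ?case by (intro divide_left_mono mult_pos_pos) auto
  qed
  have "(\<lambda>n. real (Suc n) powr real d / 2 powr (real n powr (1/3) - 1)) \<longlonglongrightarrow> 0"
    by real_asymp
  then show "(\<lambda>n. real (Suc n) ^ d / 2 powr (real n powr (1/3) - 1)) \<longlonglongrightarrow> 0"
    by (simp only: powr_realpow of_nat_0_less_iff zero_less_Suc)
qed auto

lemma peaked_sets_eventually_nonempty: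
  "eventually (\<lambda>n. 0 < card (peaked_sets K n)) sequentially"
  using eventually_ge_at_top[of "Suc (0 + K) * Suc 0 + K"]
proof eventually_elim
  case (elim n)
  then show ?case using card_peaked_sets_lower[of 0 K n] by simp
qed

section \<open>Counts at neighbouring sizes\<close>

lemma card_peaked_sets_ratio:
  "(\<lambda>n. real (card (peaked_sets K n)) / real (card (peaked_sets K (Suc n)))) \<longlonglongrightarrow> 1"
proof (rule LIMSEQ_I)
  fix e :: real assume "0 < e"
  define f where "f n = real (card (peaked_sets K n))" for n
  \<comment> \<open>The proportion missed by raising the peak is at most 4/\<open>m\<close> plus
    twice a polynomial over the count. This \<open>m\<close> puts the first term below
    \<open>e / 2\<close>; bounding the quotient by \<open>e / 4\<close> does the same for the
    second.\<close>
  obtain m :: nat where m: "8 / e < real m" using reals_Archimedean2 by blast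
  then have m0: "0 < real m" using \<open>0 < e\<close> by (smt (verit) divide_pos_pos)
  define d where "d = 2 * m + 1"
  have lim: "(\<lambda>n. real (Suc (Suc n)) ^ d / f (Suc n)) \<longlonglongrightarrow> 0"
    unfolding f_def by (rule LIMSEQ_Suc[OF card_peaked_sets_superpolynomial])
  have "eventually (\<lambda>n. real (Suc (Suc n)) ^ d / f (Suc n) < e / 4) sequentially"
    using order_tendstoD(2)[OF lim, of "e/4"] \<open>0 < e\<close> by simp
  moreover have "eventually (\<lambda>n. 0 < f (Suc n)) sequentially"
    using peaked_sets_eventually_nonempty[of K] unfolding f_def of_nat_0_less_iff
    by (subst eventually_sequentially_Suc)
  ultimately have "eventually (\<lambda>n. norm (f n / f (Suc n) - 1) < e) sequentially"
    using eventually_gt_at_top[of K]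
  proof eventually_elim
    case (elim n)
    define D where "D = real (card {(A, B, p) \<in> peaked_sets K (Suc n). p - 1 \<in> A \<union> B})"
    have eq: "f (Suc n) = f n + D"
      unfolding f_def D_def using card_peaked_sets_Suc[OF elim(3)] by simp
    have "real m * D \<le> real (4 * card (peaked_sets K (Suc n)) + 2 * m * Suc (Suc n) ^ d)"
      unfolding D_def d_def of_nat_mult[symmetric] of_nat_le_iff by (rule card_full_le)
    also have "\<dots> = 4 * f (Suc n) + 2 * m * real (Suc (Suc n)) ^ d" by (simp add: f_def)
    also have "\<dots> < 4 * f (Suc n) + 2 * m * (e / 4 * f (Suc n))"
      using elim(1,2) m0 by (simp add: field_simps)
    also have "\<dots> < m * e / 2 * f (Suc n) + 2 * m * (e / 4 * f (Suc n))"
      using m elim(2) \<open>0 < e\<close> by (simp add: field_simps)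
    also have "\<dots> = m * (e * f (Suc n))" by (simp add: field_simps)
    finally have "D < e * f (Suc n)" using m0 by simp
    then have "D / f (Suc n) < e" using elim(2) by (simp add: field_simps)
    moreover have "f n / f (Suc n) - 1 = - (D / f (Suc n))"
      using eq elim(2) by (simp add: field_simps)
    moreover have "0 \<le> D / f (Suc n)" using elim(2) by (simp add: D_def)
    ultimately show ?case by simp
  qed
  then show "\<exists>no. \<forall>n\<ge>no. norm (real (card (peaked_sets K n)) / real (card (peaked_sets K (Suc n))) - 1) < e"
    unfolding eventually_sequentially f_def .
qed

text \<open>The quotient at distance \<open>c\<close> telescopes into \<open>c\<close> quotients of
  neighbouring counts, each tending to 1.\<close>

lemma card_peaked_sets_shift_ratio:
  "(\<lambda>n. real (card (peaked_sets K (n - c))) / real (card (peaked_sets K n))) \<longlonglongrightarrow> 1"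
proof -
  define f where "f n = real (card (peaked_sets K n))" for n
  have "(\<lambda>n. f n / f (n + c)) \<longlonglongrightarrow> 1"
  proof (induction c)
    case 0
    have "eventually (\<lambda>n. f n / f (n + 0) = 1) sequentially"
      using peaked_sets_eventually_nonempty[of K] by eventually_elim (auto simp: f_def)
    then show ?case by (rule tendsto_eventually)
  next
    case (Suc c)
    have "(\<lambda>n. f (n + c) / f (Suc (n + c))) \<longlonglongrightarrow> 1"
      using LIMSEQ_ignore_initial_segment[OF card_peaked_sets_ratio[of K], of c] by (simp add: f_def)
    from tendsto_mult[OF Suc this]
    have lim: "(\<lambda>n. f n / f (n + c) * (f (n + c) / f (Suc (n + c)))) \<longlonglongrightarrow> 1" by simp
    have "eventually (\<lambda>n. 0 < f (n + c)) sequentially"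
      using peaked_sets_eventually_nonempty[of K] unfolding f_def of_nat_0_less_iff
      by (rule sequentially_offset)
    then have "eventually (\<lambda>n. f n / f (n + c) * (f (n + c) / f (Suc (n + c))) = f n / f (n + Suc c)) sequentially"
      by eventually_elim simp
    then show ?case by (rule Lim_transform_eventually[OF lim])
  qed
  \<comment> \<open>Shifting the index by \<open>c\<close> avoids the truncation of
    \<open>n - c\<close>, which affects only finitely many \<open>n\<close>.\<close>
  then have "(\<lambda>n. f (n + c - c) / f (n + c)) \<longlonglongrightarrow> 1" by simp
  then show ?thesis unfolding f_def by (rule LIMSEQ_offset)
qed


section \<open>Prescribing the parts up to a fixed bound\<close>

text \<open>A 0-1 pattern is encoded by the sets \<open>U\<close> and \<open>V\<close> of positions
  carrying a 1. The peak is not restricted by the pattern.\<close>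

definition small_part_sets :: "nat \<Rightarrow> nat \<Rightarrow> nat set \<Rightarrow> nat set \<Rightarrow> (nat set \<times> nat set \<times> nat) set" where
  "small_part_sets K n U V = {(A, B, p) \<in> peaked_sets 0 n. A \<inter> {1..K} = U \<and> B \<inter> {1..K} = V}"

lemma sum_small_parts_le:
  fixes A :: "nat set"
  assumes "A \<subseteq> {1..K}"
  shows "\<Sum>A \<le> K * K"
proof -
  have "\<Sum>A \<le> \<Sum>{1..K}" by (rule sum_mono2) (use assms in auto)
  also have "\<dots> \<le> K * K" using sum_bounded_above[of "{1..K}" "\<lambda>x. x" K] by simp
  finally show ?thesis .
qed

text \<open>Deleting the prescribed small parts lowers the size by a fixed amount and leaves a
  triple with everything above \<open>K\<close>; adjoining them again is the inverse.\<close>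

lemma card_small_part_sets:
  assumes U: "U \<subseteq> {1..K}" and V: "V \<subseteq> {1..K}" and n: "K + 2 * (K * K) < n"
  shows "card (small_part_sets K n U V) = card (peaked_sets K (n - (\<Sum>U + \<Sum>V)))"
proof -
  let ?f = "\<lambda>(A, B, p :: nat). (A - U, B - V, p)"
  let ?g = "\<lambda>(A, B, p :: nat). (A \<union> U, B \<union> V, p)"
  have s: "\<Sum>U + \<Sum>V < n"
    using sum_small_parts_le[OF U] sum_small_parts_le[OF V] n by linarith
  have f: "?f x \<in> peaked_sets K (n - (\<Sum>U + \<Sum>V)) \<and> ?g (?f x) = x"
    if x: "x \<in> small_part_sets K n U V" for x
  proof -
    obtain A B p where [simp]: "x = (A, B, p)" by (cases x)
    have xx: "(A, B, p) \<in> peaked_sets 0 n" "A \<inter> {1..K} = U" "B \<inter> {1..K} = V"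
      using x by (auto simp: small_part_sets_def)
    then have A: "A \<subseteq> {0<..<p}" "B \<subseteq> {0<..<p}" "p + \<Sum>A + \<Sum>B = n"
      by (auto simp: peaked_sets_def)
    have fin: "finite A" "finite B" using peaked_sets_finite_parts[OF xx(1)] .
    \<comment> \<open>This is where the bound on \<open>n\<close> enters: a peak of at most
      \<open>K\<close> would confine all parts to \<open>{1..K}\<close>, and the size could not
      exceed \<open>K + 2 * (K * K)\<close>.\<close>
    have "K < p"
    proof (rule ccontr)
      assume "\<not> K < p"
      then have "p \<le> K" by simp
      then have "A \<subseteq> {1..K}" "B \<subseteq> {1..K}" using A(1,2) by (auto simp: subset_iff Suc_le_eq)
      then show False using \<open>p \<le> K\<close> sum_small_parts_le[of A K] sum_small_parts_le[of B K] A(3) n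
        by linarith
    qed
    moreover have "A - U \<subseteq> {K<..<p}" "B - V \<subseteq> {K<..<p}"
      using A(1,2) unfolding xx(2,3)[symmetric] by (auto simp: Suc_le_eq)
    moreover have UA: "U \<subseteq> A" "V \<subseteq> B" using xx by auto
    moreover have "\<Sum>A = \<Sum>(A - U) + \<Sum>U" "\<Sum>B = \<Sum>(B - V) + \<Sum>V"
      using UA fin by (auto intro: sum.subset_diff)
    ultimately show ?thesis using A(3) by (auto simp: peaked_sets_def)
  qed
  have g: "?g x \<in> small_part_sets K n U V \<and> ?f (?g x) = x"
    if x: "x \<in> peaked_sets K (n - (\<Sum>U + \<Sum>V))" for x
  proof -
    obtain A B p where [simp]: "x = (A, B, p)" by (cases x)
    have A: "A \<subseteq> {K<..<p}" "B \<subseteq> {K<..<p}" "K < p" "p + \<Sum>A + \<Sum>B = n - (\<Sum>U + \<Sum>V)"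
      using x by (auto simp: peaked_sets_def)
    have fin: "finite A" "finite B" using peaked_sets_finite_parts x by auto
    have dis: "A \<inter> {1..K} = {}" "B \<inter> {1..K} = {}" using A(1,2) by (auto simp: subset_iff)
    have "A \<inter> U = {}" "B \<inter> V = {}" using dis U V by auto
    moreover have "finite U" "finite V" using U V finite_subset by blast+
    ultimately have sums: "\<Sum>(A \<union> U) = \<Sum>A + \<Sum>U" "\<Sum>(B \<union> V) = \<Sum>B + \<Sum>V"
      using fin by (auto intro: sum.union_disjoint)
    have "U \<subseteq> {0<..<p}" "V \<subseteq> {0<..<p}" using U V A(3) by (auto simp: subset_iff Suc_le_eq)
    moreover have "A \<subseteq> {0<..<p}" "B \<subseteq> {0<..<p}" using A(1,2) by (auto simp: subset_iff)
    moreover have "p + \<Sum>(A \<union> U) + \<Sum>(B \<union> V) = n" using sums A(4) s by linarith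
    ultimately have "(A \<union> U, B \<union> V, p) \<in> peaked_sets 0 n" using A(3) by (simp add: peaked_sets_def)
    moreover have "(A \<union> U) \<inter> {1..K} = U" "(B \<union> V) \<inter> {1..K} = V" using dis U V by blast+
    moreover have "(A \<union> U) - U = A" "(B \<union> V) - V = B" using dis U V by blast+
    ultimately show ?thesis by (simp add: small_part_sets_def)
  qed
  have "bij_betw ?f (small_part_sets K n U V) (peaked_sets K (n - (\<Sum>U + \<Sum>V)))"
    using f g by (intro bij_betw_byWitness[of _ ?g]) blast+
  then show ?thesis by (rule bij_betw_same_card)
qed

lemma card_peaked_sets_eq_sum:
  "card (peaked_sets 0 n) =
    (\<Sum>(U, V) \<in> Pow {1..K} \<times> Pow {1..K}. card (small_part_sets K n U V))"
proof -
  let ?g = "\<lambda>(A, B, p :: nat). (A \<inter> {1..K}, B \<inter> {1..K})"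
  have "card (peaked_sets 0 n) = (\<Sum>x\<in>peaked_sets 0 n. 1)" by simp
  also have "\<dots> = (\<Sum>y \<in> Pow {1..K} \<times> Pow {1..K}. \<Sum>x \<in> {x \<in> peaked_sets 0 n. ?g x = y}. 1)"
    by (rule sum.group[symmetric]) (auto intro: finite_peaked_sets)
  also have "\<dots> = (\<Sum>(U, V) \<in> Pow {1..K} \<times> Pow {1..K}. card (small_part_sets K n U V))"
    by (intro sum.cong refl) (auto simp: small_part_sets_def intro!: arg_cong[of _ _ card])
  finally show ?thesis .
qed

text \<open>All 4^\<open>K\<close> patterns have counts of the form f(n - s) with s fixed, so after
  division by f(n) each tends to 1. The frequency is one such quotient over the sum of all of
  them.\<close>

lemma small_part_sets_frequency:
  assumes U: "U \<subseteq> {1..K}" and V: "V \<subseteq> {1..K}"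
  shows "(\<lambda>n. card (small_part_sets K n U V) / card (peaked_sets 0 n)) \<longlonglongrightarrow> 1 / 2 ^ (2 * K)"
proof -
  let ?P = "Pow {1..K} \<times> Pow {1..K}"
  define f where "f n = real (card (peaked_sets K n))" for n
  define q where "q U V n = f (n - (\<Sum>U + \<Sum>V)) / f n" for U V :: "nat set" and n
  have lim: "q U V \<longlonglongrightarrow> 1" for U V
    unfolding q_def f_def by (rule card_peaked_sets_shift_ratio)
  have "(\<lambda>n. q U V n / (\<Sum>(U, V) \<in> ?P. q U V n)) \<longlonglongrightarrow> 1 / (\<Sum>(U, V) \<in> ?P. 1)"
    unfolding case_prod_unfold
    by (intro tendsto_divide tendsto_sum lim) (simp add: card_cartesian_product card_Pow)
  moreover have "(\<Sum>(U, V) \<in> ?P. 1 :: real) = 2 ^ (2 * K)"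
    by (simp add: case_prod_unfold card_cartesian_product card_Pow mult_2 power_add)
  ultimately have "(\<lambda>n. q U V n / (\<Sum>(U, V) \<in> ?P. q U V n)) \<longlonglongrightarrow> 1 / 2 ^ (2 * K)" by simp
  moreover have "eventually (\<lambda>n. q U V n / (\<Sum>(U, V) \<in> ?P. q U V n) =
      card (small_part_sets K n U V) / card (peaked_sets 0 n)) sequentially"
    using peaked_sets_eventually_nonempty[of K] eventually_gt_at_top[of "K + 2 * (K * K)"]
  proof eventually_elim
    case (elim n)
    then have "0 < f n" by (simp add: f_def)
    have q: "real (card (small_part_sets K n U V)) = q U V n * f n" if "(U, V) \<in> ?P" for U V
      using that card_small_part_sets[OF _ _ elim(2), of U V] \<open>0 < f n\<close> by (auto simp: q_def f_def)
    have "real (card (peaked_sets 0 n)) = (\<Sum>(U, V) \<in> ?P. real (card (small_part_sets K n U V)))"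
      unfolding card_peaked_sets_eq_sum[of n K] by (simp add: case_prod_unfold)
    also have "\<dots> = (\<Sum>(U, V) \<in> ?P. q U V n * f n)"
      by (intro sum.cong refl) (use q in auto)
    also have "\<dots> = (\<Sum>(U, V) \<in> ?P. q U V n) * f n"
      by (simp add: case_prod_unfold sum_distrib_right)
    finally show ?case using q[of U V] U V \<open>0 < f n\<close> by simp
  qed
  ultimately show ?thesis by (rule Lim_transform_eventually)
qed

section \<open>From lists to sets of parts\<close>

definition part_sets :: "peaked_seq \<Rightarrow> nat set \<times> nat set \<times> nat" where
  "part_sets u = (set (left_parts u), set (right_parts u), peak u)"

text \<open>Brings the order conditions into the form that \<open>sorted_list_of_set\<close>
  inverts. The right side is read away from the peak and decreases, hence the
  \<open>rev\<close>.\<close>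

lemma strongly_unimodal_lists:
  "strongly_unimodal u \<longleftrightarrow>
    set (left_parts u) \<subseteq> {0<..<peak u} \<and> set (right_parts u) \<subseteq> {0<..<peak u} \<and> 0 < peak u \<and>
    sorted (left_parts u) \<and> distinct (left_parts u) \<and>
    sorted (rev (right_parts u)) \<and> distinct (right_parts u)"
proof -
  have "sorted_wrt (>) (right_parts u) \<longleftrightarrow> sorted (rev (right_parts u)) \<and> distinct (right_parts u)"
    using strict_sorted_iff[of "rev (right_parts u)"] by (simp add: sorted_wrt_rev)
  then show ?thesis
    by (simp add: strongly_unimodal_def sorted_wrt_append strict_sorted_iff subset_iff) blast
qed

lemma bij_betw_part_sets: "bij_betw part_sets (strongly_unimodal_seqs n) (peaked_sets 0 n)"
proof -
  let ?g = "\<lambda>(A, B, p). Peaked_Seq (sorted_list_of_set A) p (rev (sorted_list_of_set B))"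
  have f: "part_sets u \<in> peaked_sets 0 n \<and> ?g (part_sets u) = u"
    if u: "u \<in> strongly_unimodal_seqs n" for u
  proof -
    obtain xs p ys where [simp]: "u = Peaked_Seq xs p ys" by (cases u)
    have "distinct xs" "distinct ys" "sorted xs" "sorted (rev ys)"
      "set xs \<subseteq> {0<..<p}" "set ys \<subseteq> {0<..<p}" "0 < p" "p + sum_list xs + sum_list ys = n"
      using u by (auto simp: strongly_unimodal_seqs_def strongly_unimodal_lists seq_size_def)
    then show ?thesis
      using sorted_list_of_set.idem_if_sorted_distinct[of "rev ys"]
      by (simp add: part_sets_def peaked_sets_def distinct_sum_list_conv_Sum
          sorted_list_of_set.idem_if_sorted_distinct)
  qed
  have g: "?g x \<in> strongly_unimodal_seqs n \<and> part_sets (?g x) = x" if x: "x \<in> peaked_sets 0 n" for x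
  proof -
    obtain A B p where [simp]: "x = (A, B, p)" by (cases x)
    have "finite A" "finite B" using peaked_sets_finite_parts x by auto
    then show ?thesis using x
      by (auto simp: part_sets_def peaked_sets_def strongly_unimodal_seqs_def strongly_unimodal_lists
          seq_size_def distinct_sum_list_conv_Sum)
  qed
  show ?thesis using f g by (intro bij_betw_byWitness[of _ ?g]) blast+
qed

lemma count_list_distinct: "distinct xs \<Longrightarrow> count_list xs i = (if i \<in> set xs then 1 else 0)"
  by (induction xs) auto

text \<open>In a list without repetitions each count is 0 or 1, so matching a 0-1 pattern means
  having a prescribed intersection with \<open>{1..K}\<close>. The bijection
  \<open>part_sets\<close> then turns the probability into a quotient of cardinalities.\<close>

lemma prob_small_parts:
  fixes w :: "side \<Rightarrow> nat \<Rightarrow> nat"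
  assumes "1 \<le> n" and w: "\<And>j i. i \<in> {1..K} \<Longrightarrow> w j i \<in> {0, 1}"
  shows "measure_pmf.prob (uniform_unimodal n) {u. \<forall>j. \<forall>i \<in> {1..K}. part_count j i u = w j i} =
    card (small_part_sets K n {i \<in> {1..K}. w SideL i = 1} {i \<in> {1..K}. w SideR i = 1})
      / card (peaked_sets 0 n)"
    (is "_ = card ?S / _")
proof -
  let ?E = "{u. \<forall>j. \<forall>i \<in> {1..K}. part_count j i u = w j i}"
  have side: "(\<forall>i \<in> {1..K}. count_list xs i = w j i) \<longleftrightarrow> set xs \<inter> {1..K} = {i \<in> {1..K}. w j i = 1}"
    if "distinct xs" for xs j
  proof -
    have "(\<forall>i \<in> {1..K}. count_list xs i = w j i) \<longleftrightarrow> (\<forall>i \<in> {1..K}. i \<in> set xs \<longleftrightarrow> w j i = 1)"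
    proof (intro ball_cong refl)
      fix i assume "i \<in> {1..K}"
      from w[OF this, of j] show "count_list xs i = w j i \<longleftrightarrow> (i \<in> set xs \<longleftrightarrow> w j i = 1)"
        unfolding count_list_distinct[OF that] by auto
    qed
    then show ?thesis by blast
  qed
  have all: "(\<forall>j. P j) \<longleftrightarrow> P SideL \<and> P SideR" for P by (metis side.exhaust)
  have "u \<in> ?E \<longleftrightarrow> part_sets u \<in> ?S" if u: "u \<in> strongly_unimodal_seqs n" for u
  proof -
    have "distinct (left_parts u)" "distinct (right_parts u)"
      using u by (auto simp: strongly_unimodal_seqs_def strongly_unimodal_lists)
    moreover have "part_sets u \<in> peaked_sets 0 n"
      using bij_betw_part_sets[of n] u by (auto simp: bij_betw_def)
    ultimately show ?thesis
      by (simp add: part_count_def all side small_part_sets_def part_sets_def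
          del: One_nat_def atLeastAtMost_iff)
  qed
  then have "strongly_unimodal_seqs n \<inter> ?E = {u \<in> strongly_unimodal_seqs n. part_sets u \<in> ?S}"
    by blast
  moreover have "?S = part_sets ` {u \<in> strongly_unimodal_seqs n. part_sets u \<in> ?S}"
  proof -
    have "S = f ` {u \<in> X. f u \<in> S}" if "S \<subseteq> f ` X" for S and f :: "peaked_seq \<Rightarrow> _" and X
      using that by blast
    moreover have "?S \<subseteq> part_sets ` strongly_unimodal_seqs n"
      unfolding bij_betw_imp_surj_on[OF bij_betw_part_sets] by (auto simp: small_part_sets_def)
    ultimately show ?thesis by blast
  qed
  moreover have "inj_on part_sets {u \<in> strongly_unimodal_seqs n. part_sets u \<in> ?S}"
    by (rule inj_on_subset[OF bij_betw_imp_inj_on[OF bij_betw_part_sets[of n]]]) auto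
  ultimately have "card (strongly_unimodal_seqs n \<inter> ?E) = card ?S"
    by (metis (no_types, lifting) card_image)
  then show ?thesis
    unfolding uniform_unimodal_def bij_betw_same_card[OF bij_betw_part_sets, symmetric]
    using measure_pmf_of_set[OF strongly_unimodal_seqs_nonempty[OF assms(1)] finite_strongly_unimodal_seqs, of ?E]
    by simp
qed

section \<open>Patterns that vary with the size\<close>

text \<open>There are only finitely many patterns of length at most \<open>K0\<close>, so one
  threshold for \<open>n\<close> serves them all. This is needed because the pattern in the theorem
  changes with \<open>n\<close>.\<close>

lemma small_part_sets_frequency_uniform:
  fixes K0 :: nat
  assumes "0 < e"
  shows "eventually (\<lambda>n. \<forall>K \<le> K0. \<forall>U \<subseteq> {1..K}. \<forall>V \<subseteq> {1..K}.
    \<bar>card (small_part_sets K n U V) / card (peaked_sets 0 n) - 1 / 2 ^ (2 * K)\<bar> < e) sequentially"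
proof -
  have "eventually (\<lambda>n. \<forall>K \<in> {..K0}. \<forall>U \<in> Pow {1..K}. \<forall>V \<in> Pow {1..K}.
    \<bar>card (small_part_sets K n U V) / card (peaked_sets 0 n) - 1 / 2 ^ (2 * K)\<bar> < e) sequentially"
  proof (intro eventually_ball_finite ballI)
    fix K :: nat and U V assume "U \<in> Pow {1..K}" "V \<in> Pow {1..K}"
    then show "eventually (\<lambda>n. \<bar>card (small_part_sets K n U V) / card (peaked_sets 0 n)
        - 1 / 2 ^ (2 * K)\<bar> < e) sequentially"
      using tendstoD[OF small_part_sets_frequency assms, of U K V] by (simp add: dist_real_def)
  qed auto
  then show ?thesis by (simp add: Ball_def)
qed

theorem theorem1p11:
  fixes k :: "nat \<Rightarrow> nat" and w :: "nat \<Rightarrow> side \<Rightarrow> nat \<Rightarrow> nat"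
  assumes "\<And>n. n \<ge> 1 \<Longrightarrow> k n \<ge> 1"
    and "(\<lambda>n. real (k n)) \<in> o(\<lambda>n. real n powr (1/2))"
    and "\<And>n j i. n \<ge> 1 \<Longrightarrow> i \<in> {1..k n} \<Longrightarrow> w n j i \<in> {0, 1}"
  shows "(\<lambda>n. measure_pmf.prob (uniform_unimodal n)
                {u. \<forall>j. \<forall>i \<in> {1..k n}. part_count j i u = w n j i}
              - 1 / 2 ^ (2 * k n)) \<longlonglongrightarrow> 0"
proof (rule tendstoI)
  fix e :: real assume "0 < e"
  \<comment> \<open>\<open>K0\<close> is chosen so that a pattern of this length has limiting
    probability 4^-\<open>K0\<close> below \<open>e / 2\<close>.\<close>
  have "(\<lambda>K. (1/4) ^ K :: real) \<longlonglongrightarrow> 0" by (rule LIMSEQ_realpow_zero) auto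
  from order_tendstoD(2)[OF this, of "e/2"] \<open>0 < e\<close> obtain K0 where "(1/4 :: real) ^ K0 < e / 2"
    by (auto simp: eventually_sequentially)
  then have K0: "1 / 2 ^ (2 * K0) < e / 2" by (simp add: power_mult power_one_over)
  let ?E = "\<lambda>n K. {u. \<forall>j. \<forall>i \<in> {1..K}. part_count j i u = w n j i}"
  let ?P = "\<lambda>n K. measure_pmf.prob (uniform_unimodal n) (?E n K)"
  have "eventually (\<lambda>n. \<forall>K \<le> K0. \<forall>U \<subseteq> {1..K}. \<forall>V \<subseteq> {1..K}.
    \<bar>card (small_part_sets K n U V) / card (peaked_sets 0 n) - 1 / 2 ^ (2 * K)\<bar> < e / 2) sequentially"
    using \<open>0 < e\<close> by (intro small_part_sets_frequency_uniform) simp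
  then show "eventually (\<lambda>n. dist (?P n (k n) - 1 / 2 ^ (2 * k n)) 0 < e) sequentially"
    using eventually_ge_at_top[of 1]
  proof eventually_elim
    case (elim n)
    have close: "\<bar>?P n K - 1 / 2 ^ (2 * K)\<bar> < e / 2" if K: "K \<le> K0" "K \<le> k n" for K
    proof -
      have "w n j i \<in> {0, 1}" if "i \<in> {1..K}" for j i
        using assms(3)[OF elim(2), of i j] that K(2) by simp
      from prob_small_parts[of n K "w n", OF elim(2) this] show ?thesis
        using elim(1)[rule_format, OF K(1)] by (metis (no_types, lifting) mem_Collect_eq subsetI)
    qed
    show ?case
    proof (cases "k n \<le> K0")
      case True
      then show ?thesis using close[of "k n"] \<open>0 < e\<close> by simp
    next
      case False
      \<comment> \<open>Forgetting the entries beyond \<open>K0\<close> enlarges the event, whose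
        probability is still below 4^-\<open>K0\<close> + \<open>e / 2\<close> and hence below
        \<open>e\<close>. Both terms of the difference thus lie between 0 and
        \<open>e\<close>.\<close>
      then have "?E n (k n) \<subseteq> ?E n K0" by auto
      then have "?P n (k n) \<le> ?P n K0" by (intro measure_pmf.finite_measure_mono) auto
      moreover have "\<bar>?P n K0 - 1 / 2 ^ (2 * K0)\<bar> < e / 2" using close False by simp
      moreover have "1 / 2 ^ (2 * k n) \<le> (1 / 2 ^ (2 * K0) :: real)"
        using False by (intro divide_left_mono power_increasing) auto
      moreover have "0 \<le> ?P n (k n)" "0 \<le> (1 / 2 ^ (2 * k n) :: real)" by auto
      ultimately show ?thesis using K0 unfolding dist_real_def by linarith
    qed
  qed
qed

end
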